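(* The size of the symmetry group $G_n=G_n(w)$ of the period-doubling word $w$ satisfies the following lower bound: $|G_n|>2^{\frac{n}{3}}$. In particular, $|G_{2^n}|=2^{2^n-1}$.
   Context: The period-doubling word $w=w_1w_2w_3\cdots=0100010101000100\cdots$ is the binary word with letters $w_i\in\{0,1\}$ defined by $w_i\equiv k\pmod 2$, where $i=2^kl$ and $l$ is odd. $F_n(w)$ denotes the set of factors of length $n$ of $w$, and $S_n$ the group of permutations on $n$ elements. A permutation $g\in S_n$ acts on a word $u=u_1\cdots u_n$ by $g(u)=u_{g^{-1}(1)}\cdots u_{g^{-1}(n)}$; the symmetry group of order $n$ of $w$ is $G_n(w)=\{\pi\in S_n \mid \pi(x)\in F_n(w)\text{ for each }x\in F_n(w)\}$.
   Formalization: The strict bound |G_n| > 2^{n/3} is stated for n ≥ 1 with n ≠ 1, 3, since it fails at n = 1 (|G_1| = 1 < 2^{1/3}) and at n = 3 (|G_3| = 2 = 2^{3/3}, equality). *)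

theory Defs
  imports Complex_Main "HOL-Computational_Algebra.Primes" "HOL-Combinatorics.Permutations"
begin

text \<open>
  An infinite word \<open>w = w\<^sub>1w\<^sub>2w\<^sub>3\<dots>\<close> is a function on \<^typ>\<open>nat\<close> that is only ever inspected at
  positive arguments; finite words are lists.
\<close>

definition factors :: "nat \<Rightarrow> (nat \<Rightarrow> 'a) \<Rightarrow> 'a list set" where
  "factors n w = {map w [i..<i + n] | i. i \<ge> 1}"

text \<open>
  The symmetric group \<open>S\<^sub>n\<close> is realised on the list positions \<^term>\<open>{..<n}\<close>.  As
  \<^term>\<open>permute_list f u\<close> has \<^term>\<open>u ! f i\<close> at position \<open>i\<close>, the inverse
  gives the left action \<open>g(u)\<^sub>i = u\<^bsub>g\<^sup>-\<^sup>1(i)\<^esub>\<close>.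
\<close>

definition perm_word :: "(nat \<Rightarrow> nat) \<Rightarrow> 'a list \<Rightarrow> 'a list" where
  "perm_word g u = permute_list (inv g) u"

definition symmetry_group :: "nat \<Rightarrow> (nat \<Rightarrow> 'a) \<Rightarrow> (nat \<Rightarrow> nat) set" where
  "symmetry_group n w =
    {g. g permutes {..<n} \<and> (\<forall>x \<in> factors n w. perm_word g x \<in> factors n w)}"

definition period_doubling :: "nat \<Rightarrow> nat" where
  "period_doubling i = multiplicity 2 i mod 2"

lemma period_doubling_power_mult:
  assumes "odd l"
  shows "period_doubling (2 ^ k * l) = k mod 2"
proof -
  have "multiplicity 2 (2 ^ k * l) = k"
    using assms by (intro multiplicity_eqI) auto
  then show ?thesis
    by (simp add: period_doubling_def)
qed

end

theory Submission
  imports Defs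
begin

text \<open>
  The period-doubling word satisfies \<open>w(2i + 1) = 0\<close> and \<open>w(2i) = 1 - w(i)\<close>, so a factor of length
  \<open>n\<close> is obtained by placing zeros on one parity class of positions and the complement of a shorter
  factor on the other.  Letting symmetries act independently on the two classes embeds
  \<open>G\<^bsub>m+1\<^esub> \<times> G\<^sub>m\<close> into \<open>G\<^bsub>2m+1\<^esub>\<close> and \<open>G\<^sub>m \<times> G\<^sub>m\<close> into \<open>G\<^bsub>2m\<^esub>\<close>; in the even case the two classes
  can also be exchanged.  Two positions that carry a 1 simultaneously in some factor have the same
  parity, and this relation connects each parity class; hence every element of \<open>G\<^bsub>2m\<^esub>\<close> preserves or
  exchanges the classes, and \<open>|G\<^bsub>2m\<^esub>| = 2 |G\<^sub>m|\<^sup>2\<close>.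
\<close>

section \<open>Arithmetic of the letters\<close>

lemma period_doubling_odd: "odd i \<Longrightarrow> period_doubling i = 0"
  using period_doubling_power_mult[of i 0] by simp

lemma period_doubling_le_1: "period_doubling i \<le> 1"
  unfolding period_doubling_def by linarith

lemma period_doubling_double:
  assumes "i \<ge> 1"
  shows "period_doubling (2 * i) = 1 - period_doubling i"
proof -
  have "multiplicity 2 (2 * i) = Suc (multiplicity 2 i)"
    using assms by (intro multiplicity_times_same) auto
  then show ?thesis
    unfolding period_doubling_def by presburger
qed

text \<open>\<open>i\<close> is twice an odd number. This gives ones on a whole residue class, on
  which the rigidity of the parity classes rests.\<close>

lemma period_doubling_mod_4:
  assumes "i mod 4 = 2"
  shows "period_doubling i = 1"
proof -
  have "i = 2 * (i div 2)" "odd (i div 2)"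
    using assms by presburger+
  then show ?thesis
    using period_doubling_power_mult[of "i div 2" 1] by simp
qed

section \<open>Permutations of an initial segment\<close>

text \<open>An injective self-map of a finite set is onto, so no inverse has to be
  exhibited.\<close>

lemma permutes_lessThanI:
  fixes f :: "nat \<Rightarrow> nat"
  assumes "\<And>i. i < n \<Longrightarrow> f i < n" "\<And>i j. i < n \<Longrightarrow> j < n \<Longrightarrow> f i = f j \<Longrightarrow> i = j"
    "\<And>i. n \<le> i \<Longrightarrow> f i = i"
  shows "f permutes {..<n}"
proof (rule bij_imp_permutes)
  have "inj_on f {..<n}"
    using assms(2) by (auto simp: inj_on_def)
  moreover from this have "f ` {..<n} = {..<n}"
    using assms(1) by (intro endo_inj_surj) auto
  ultimately show "bij_betw f {..<n} {..<n}"
    by (simp add: bij_betw_def)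
qed (use assms(3) in auto)

lemma permutes_lessThan_less: "g permutes {..<n} \<Longrightarrow> g i < n \<longleftrightarrow> i < n"
  using permutes_in_image[of g "{..<n}" i] by simp

lemma permutes_lessThan_ge: "g permutes {..<n} \<Longrightarrow> n \<le> (i::nat) \<Longrightarrow> g i = i"
  by (rule permutes_not_in) auto

lemma permutes_eq_iff: "g permutes A \<Longrightarrow> g i = g j \<longleftrightarrow> i = j"
  using permutes_inj[of g A] by (auto dest: injD)

section \<open>Factors and symmetry groups of an arbitrary word\<close>

lemma mem_factors_iff:
  "x \<in> factors n w \<longleftrightarrow> length x = n \<and> (\<exists>k\<ge>1. \<forall>j<n. x ! j = w (k + j))"
proof
  assume "x \<in> factors n w"
  then show "length x = n \<and> (\<exists>k\<ge>1. \<forall>j<n. x ! j = w (k + j))"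
    unfolding factors_def by auto
next
  assume *: "length x = n \<and> (\<exists>k\<ge>1. \<forall>j<n. x ! j = w (k + j))"
  then obtain k where k: "k \<ge> 1" "\<forall>j<n. x ! j = w (k + j)"
    by blast
  have "x = map w [k..<k + n]"
    using * k by (intro nth_equalityI) auto
  with k(1) show "x \<in> factors n w"
    unfolding factors_def by blast
qed

text \<open>Substituting \<open>g j\<close> for the position eliminates the inverse from the action.\<close>

lemma mem_symmetry_group_iff:
  "g \<in> symmetry_group n w \<longleftrightarrow>
    g permutes {..<n} \<and> (\<forall>k\<ge>1. \<exists>l\<ge>1. \<forall>j<n. w (l + g j) = w (k + j))"
proof (cases "g permutes {..<n}")
  case True
  have inv_perm: "inv g permutes {..<n}"
    using True by (rule permutes_inv)
  have word: "perm_word g x \<in> factors n w \<longleftrightarrow> (\<exists>l\<ge>1. \<forall>j<n. w (l + g j) = x ! j)"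
    if "length x = n" for x
  proof -
    have "(\<forall>j<n. perm_word g x ! j = w (l + j)) \<longleftrightarrow> (\<forall>j<n. w (l + g j) = x ! j)" for l
    proof -
      have "perm_word g x ! j = x ! inv g j" if "j < n" for j
        using that \<open>length x = n\<close> inv_perm by (simp add: perm_word_def permute_list_nth)
      then show ?thesis
        using permutes_lessThan_less[OF True] permutes_lessThan_less[OF inv_perm]
          permutes_inverses[OF True] by metis
    qed
    then show ?thesis
      using that by (simp add: mem_factors_iff perm_word_def)
  qed
  have "(\<forall>x\<in>factors n w. perm_word g x \<in> factors n w) \<longleftrightarrow>
      (\<forall>k\<ge>1. \<exists>l\<ge>1. \<forall>j<n. w (l + g j) = w (k + j))"
  proof -
    have "(\<forall>x\<in>factors n w. perm_word g x \<in> factors n w) \<longleftrightarrow>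
        (\<forall>k\<ge>1. perm_word g (map w [k..<k + n]) \<in> factors n w)"
      unfolding factors_def by blast
    then show ?thesis
      by (simp add: word)
  qed
  then show ?thesis
    using True by (simp add: symmetry_group_def)
qed (simp add: symmetry_group_def)

lemma symmetry_groupD:
  assumes "g \<in> symmetry_group n w"
  shows "g permutes {..<n}"
    and "k \<ge> 1 \<Longrightarrow> \<exists>l\<ge>1. \<forall>j<n. w (l + g j) = w (k + j)"
  using assms unfolding mem_symmetry_group_iff by blast+

lemma finite_symmetry_group: "finite (symmetry_group n w)"
  by (rule finite_subset[of _ "{g. g permutes {..<n}}"])
     (auto simp: symmetry_group_def finite_permutations)

lemma symmetry_group_comp:
  assumes "g \<in> symmetry_group n w" "h \<in> symmetry_group n w"
  shows "g \<circ> h \<in> symmetry_group n w"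
  unfolding mem_symmetry_group_iff
proof (intro conjI allI impI)
  note g = symmetry_groupD[OF assms(1)] and h = symmetry_groupD[OF assms(2)]
  show "g \<circ> h permutes {..<n}"
    using h(1) g(1) by (rule permutes_compose)
  fix k :: nat
  assume "k \<ge> 1"
  then obtain l where l: "l \<ge> 1" "\<forall>j<n. w (l + h j) = w (k + j)"
    using h(2) by blast
  obtain l' where "l' \<ge> 1" "\<forall>j<n. w (l' + g j) = w (l + j)"
    using g(2)[OF l(1)] by blast
  then show "\<exists>l\<ge>1. \<forall>j<n. w (l + (g \<circ> h) j) = w (k + j)"
    using l permutes_lessThan_less[OF h(1)] by (metis comp_apply)
qed

section \<open>Independent action on the two parity classes\<close>

definition weave :: "(nat \<Rightarrow> nat) \<Rightarrow> (nat \<Rightarrow> nat) \<Rightarrow> nat \<Rightarrow> nat" where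
  "weave g h j = (if even j then 2 * g (j div 2) else 2 * h (j div 2) + 1)"

lemma weave_double [simp]: "weave g h (2 * t) = 2 * g t"
  and weave_Suc_double [simp]: "weave g h (Suc (2 * t)) = Suc (2 * h t)"
  by (simp_all add: weave_def)

lemma even_weave [simp]: "even (weave g h j) \<longleftrightarrow> even j"
  by (simp add: weave_def)

lemma inj_weave: "inj (\<lambda>(g, h). weave g h)"
proof (rule injI, clarify)
  fix g h g' h'
  assume eq: "weave g h = weave g' h'"
  have "g t = g' t" for t
    using fun_cong[OF eq, of "2 * t"] by simp
  moreover have "h t = h' t" for t
    using fun_cong[OF eq, of "Suc (2 * t)"] by simp
  ultimately show "g = g' \<and> h = h'"
    by blast
qed

text \<open>The bounds on \<open>a\<close> and \<open>b\<close> say that \<open>{..<a + b}\<close>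
  has exactly \<open>a\<close> even and \<open>b\<close> odd positions: either \<open>a = b\<close>
  or \<open>a = b + 1\<close>.\<close>

lemma weave_permutes:
  assumes g: "g permutes {..<a}" and h: "h permutes {..<b}" and ab: "b \<le> a" "a \<le> b + 1"
  shows "weave g h permutes {..<a + b}"
proof (rule permutes_lessThanI)
  fix i
  assume i: "i < a + b"
  show "weave g h i < a + b"
  proof (cases "even i")
    case True
    with i ab have "i div 2 < a" by presburger
    then have "g (i div 2) < a"
      using permutes_lessThan_less[OF g] by blast
    with True ab show ?thesis by (simp add: weave_def)
  next
    case False
    with i ab have "i div 2 < b" by presburger
    then have "h (i div 2) < b"
      using permutes_lessThan_less[OF h] by blast
    with False ab show ?thesis by (simp add: weave_def)
  qed
next
  fix i
  assume i: "a + b \<le> i"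
  show "weave g h i = i"
  proof (cases "even i")
    case True
    with i ab have "a \<le> i div 2" by presburger
    with True permutes_lessThan_ge[OF g] show ?thesis by (simp add: weave_def)
  next
    case False
    with i ab have "b \<le> i div 2" by presburger
    with False permutes_lessThan_ge[OF h] show ?thesis by (simp add: weave_def)
  qed
next
  fix i j
  assume eq: "weave g h i = weave g h j"
  then have "even i \<longleftrightarrow> even j"
    by (metis even_weave)
  moreover from this eq have "i div 2 = j div 2"
    by (auto simp: weave_def permutes_eq_iff[OF g] permutes_eq_iff[OF h] split: if_splits)
  ultimately show "i = j"
    by presburger
qed

text \<open>Ones occur only at even indices, and the parity of the start \<open>k\<close> decides
  which class of positions meets them. So in each factor one of \<open>g\<close> and
  \<open>h\<close> merely permutes zeros, and the other one supplies the new start.\<close>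

lemma weave_mem_symmetry_group:
  assumes G: "g \<in> symmetry_group a period_doubling" and H: "h \<in> symmetry_group b period_doubling"
    and ab: "b \<le> a" "a \<le> b + 1"
  shows "weave g h \<in> symmetry_group (a + b) period_doubling"
  unfolding mem_symmetry_group_iff
proof (intro conjI allI impI)
  note g = symmetry_groupD[OF G] and h = symmetry_groupD[OF H]
  show "weave g h permutes {..<a + b}"
    using g(1) h(1) ab by (rule weave_permutes)
  fix k :: nat
  assume k: "k \<ge> 1"
  show "\<exists>l\<ge>1. \<forall>j<a + b. period_doubling (l + weave g h j) = period_doubling (k + j)"
  proof (cases "even k")
    case True
    then obtain k' where k': "k = 2 * k'" "k' \<ge> 1"
      using k by (auto elim!: evenE)
    obtain l where l: "l \<ge> 1" "\<forall>j<a. period_doubling (l + g j) = period_doubling (k' + j)"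
      using g(2)[OF k'(2)] by blast
    have "period_doubling (2 * l + weave g h j) = period_doubling (k + j)" if "j < a + b" for j
    proof (cases "even j")
      case True
      then obtain t where t: "j = 2 * t" by (elim evenE)
      have "t < a" using that t ab by linarith
      have "period_doubling (2 * (l + g t)) = period_doubling (2 * (k' + t))"
        using l k'(2) \<open>t < a\<close> by (simp only: period_doubling_double trans_le_add1)
      then show ?thesis by (simp add: t k'(1) distrib_left)
    next
      case False
      then show ?thesis by (simp add: k'(1) period_doubling_odd)
    qed
    then show ?thesis using l(1) by (intro exI[of _ "2 * l"]) auto
  next
    case False
    then obtain k' where k': "k = 2 * k' + 1"
      by (elim oddE)
    obtain l where l: "l \<ge> 1" "\<forall>j<b. period_doubling (l + h j) = period_doubling (Suc k' + j)"
      using h(2)[of "Suc k'"] by auto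
    \<comment> \<open>An odd start puts position \<open>2 * h t + 1\<close> at the even index
      \<open>2 * (l + h t)\<close>; \<open>l \<ge> 1\<close> keeps the subtraction exact.\<close>
    have "period_doubling (2 * l - 1 + weave g h j) = period_doubling (k + j)" if "j < a + b" for j
    proof (cases "even j")
      case True
      then show ?thesis using l(1) by (simp add: k' period_doubling_odd)
    next
      case False
      then obtain t where t: "j = 2 * t + 1" by (elim oddE)
      have "t < b" using that t ab by linarith
      have "period_doubling (2 * (l + h t)) = period_doubling (2 * (Suc k' + t))"
        using l \<open>t < b\<close> le_add1[of 1 k']
        by (simp only: period_doubling_double trans_le_add1 flip: plus_1_eq_Suc)
      moreover have "2 * l - 1 + weave g h j = 2 * (l + h t)" "k + j = 2 * (Suc k' + t)"
        using l(1) by (simp_all add: t k')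
      ultimately show ?thesis by simp
    qed
    then show ?thesis using l(1) by (intro exI[of _ "2 * l - 1"]) auto
  qed
qed

lemma card_weave_image:
  "card ((\<lambda>(g, h). weave g h) ` (A \<times> B)) = card A * card B"
  using card_image[OF inj_on_subset[OF inj_weave subset_UNIV]] by (simp add: card_cartesian_product)

lemma card_symmetry_group_odd:
  "card (symmetry_group (Suc m) period_doubling) * card (symmetry_group m period_doubling)
    \<le> card (symmetry_group (2 * m + 1) period_doubling)" (is "card ?A * card ?B \<le> card ?C")
proof -
  have "(\<lambda>(g, h). weave g h) ` (?A \<times> ?B) \<subseteq> ?C"
    using weave_mem_symmetry_group[of _ "Suc m" _ m] by (auto simp: mult_2)
  then have "card ((\<lambda>(g, h). weave g h) ` (?A \<times> ?B)) \<le> card ?C"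
    using finite_symmetry_group by (rule card_mono[rotated])
  then show ?thesis
    by (simp add: card_weave_image)
qed

section \<open>Exchange of the two parity classes\<close>

text \<open>For \<open>m \<ge> 1\<close> this involution represents the coset of the symmetries that
  exchange the classes.\<close>

definition swap_parity :: "nat \<Rightarrow> nat \<Rightarrow> nat" where
  "swap_parity m j = (if j < 2 * m then if even j then j + 1 else j - 1 else j)"

lemma swap_parity_swap_parity [simp]: "swap_parity m (swap_parity m j) = j"
  unfolding swap_parity_def by (auto elim!: evenE oddE)

lemma even_swap_parity: "j < 2 * m \<Longrightarrow> even (swap_parity m j) \<longleftrightarrow> odd j"
  unfolding swap_parity_def by auto

text \<open>Moving the start by one compensates the swap: in each pair the position at an even index
  keeps its index, and the other one goes from an odd index to an odd index, where the letter is
  zero.\<close>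

lemma swap_parity_mem: "swap_parity m \<in> symmetry_group (2 * m) period_doubling"
  unfolding mem_symmetry_group_iff
proof (intro conjI allI impI)
  show "swap_parity m permutes {..<2 * m}"
  proof (rule permutes_lessThanI)
    show "swap_parity m i < 2 * m" if "i < 2 * m" for i
      using that unfolding swap_parity_def by (auto elim!: evenE)
    show "i = j" if "swap_parity m i = swap_parity m j" for i j
      using that by (metis swap_parity_swap_parity)
  qed (simp add: swap_parity_def)
  fix k :: nat
  assume k: "k \<ge> 1"
  show "\<exists>l\<ge>1. \<forall>j<2 * m. period_doubling (l + swap_parity m j) = period_doubling (k + j)"
  proof (cases "even k")
    case True
    then have "k \<ge> 2" using k by presburger
    with True show ?thesis
      by (intro exI[of _ "k - 1"]) (auto simp: swap_parity_def period_doubling_odd)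
  next
    case False
    then show ?thesis
      by (intro exI[of _ "k + 1"]) (auto simp: swap_parity_def period_doubling_odd elim!: oddE)
  qed
qed

section \<open>Rigidity of the parity classes\<close>

text \<open>Ones occur only at even indices, so \<open>l + g i\<close> and \<open>l + g j\<close>
  are both even for the start \<open>l\<close> of the image factor.\<close>

lemma symmetry_parity_1:
  assumes g: "g \<in> symmetry_group n period_doubling" and "i < n" "j < n"
    and k: "k \<ge> 1" "period_doubling (k + i) = 1" "period_doubling (k + j) = 1"
  shows "even (g i) \<longleftrightarrow> even (g j)"
proof -
  obtain l where "\<forall>j<n. period_doubling (l + g j) = period_doubling (k + j)"
    using symmetry_groupD(2)[OF g k(1)] by blast
  then have "period_doubling (l + g i) = 1" "period_doubling (l + g j) = 1"
    using assms by auto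
  then have "even (l + g i)" "even (l + g j)"
    using period_doubling_odd by fastforce+
  then show ?thesis by simp
qed

text \<open>Positions are linked when they carry ones in a common factor. Links within a residue
  class mod 4 lead from \<open>i\<close> to \<open>i mod 4\<close>, and one more link joins the
  residues \<open>r\<close> and \<open>r + 2\<close>.\<close>

lemma symmetry_parity:
  assumes g: "g \<in> symmetry_group n period_doubling" and i: "i < n"
  shows "even (g i) \<longleftrightarrow> even (g (i mod 2))"
proof -
  \<comment> \<open>This start places every \<open>j\<close> congruent to \<open>i\<close> mod 4 at
    an index congruent to 2 mod 4. The constant 6 instead of 2 keeps it positive.\<close>
  have one: "period_doubling (6 - i mod 4 + j) = 1" if "j mod 4 = i mod 4" for j
  proof (rule period_doubling_mod_4)
    have "6 - i mod 4 + j = 4 * (j div 4) + 6"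
      using that mult_div_mod_eq[of 4 j] mod_less_divisor[of 4 i] by linarith
    then show "(6 - i mod 4 + j) mod 4 = 2"
      by simp
  qed
  have step: "even (g i) \<longleftrightarrow> even (g j)" if "j < n" "j mod 4 = i mod 4" for j
  proof (rule symmetry_parity_1[OF g i that(1)])
    show "6 - i mod 4 \<ge> 1"
      using mod_less_divisor[of 4 i] by linarith
  qed (rule one, simp add: that)+
  have mod2: "i mod 2 = i mod 4 mod 2"
    by (simp add: mod_mod_cancel)
  show ?thesis
  proof (cases "i mod 4 < 2")
    case True
    then have "i mod 2 = i mod 4" using mod2 by simp
    moreover have "i mod 4 < n" using mod_less_eq_dividend[of i 4] i by linarith
    ultimately show ?thesis using step[of "i mod 4"] by simp
  next
    case False
    then have "i mod 2 = i mod 4 - 2"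
      using mod2 le_mod_geq[of 2 "i mod 4"] mod_less_divisor[of 4 i] by simp
    with False have eq: "i mod 2 + 2 = i mod 4" by linarith
    then have small: "i mod 2 + 2 < n" using mod_less_eq_dividend[of i 4] i by linarith
    have "even (g i) \<longleftrightarrow> even (g (i mod 2 + 2))"
      by (rule step[OF small]) (simp only: eq mod_mod_trivial)
    also have "\<dots> \<longleftrightarrow> even (g (i mod 2))"
    proof (rule symmetry_parity_1[OF g small])
      \<comment> \<open>the occurrence of \<open>1\<cdot>1\<close> at the positions 6 and 8\<close>
      show "6 - i mod 2 \<ge> 1" "i mod 2 < n"
        using small mod_less_divisor[of 2 i] by linarith+
      have "period_doubling 8 = 1" "period_doubling 6 = 1"
        using period_doubling_power_mult[of 1 3] period_doubling_power_mult[of 3 1] by simp_all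
      moreover have "6 - i mod 2 + (i mod 2 + 2) = 8" "6 - i mod 2 + i mod 2 = 6"
        using mod_less_divisor[of 2 i] by linarith+
      ultimately show "period_doubling (6 - i mod 2 + (i mod 2 + 2)) = 1"
        "period_doubling (6 - i mod 2 + i mod 2) = 1"
        by simp_all
    qed
    finally show ?thesis .
  qed
qed

text \<open>\<open>g\<close> has constant parity on each class; being onto, it takes both values 0
  and 1, so the two constants differ.\<close>

lemma symmetry_parity_cases:
  assumes g: "g \<in> symmetry_group (2 * m) period_doubling"
  shows "(\<forall>i<2 * m. even (g i) \<longleftrightarrow> even i) \<or> (\<forall>i<2 * m. even (g i) \<longleftrightarrow> odd i)"
proof (cases "m = 0")
  case False
  have perm: "g permutes {..<2 * m}" using g by (rule symmetry_groupD)
  have par: "even (g i) \<longleftrightarrow> (if even i then even (g 0) else even (g 1))" if "i < 2 * m" for i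
    using symmetry_parity[OF g that] by (simp add: mod2_eq_if split: if_splits)
  have "\<exists>i<2 * m. g i = j" if "j < 2 * m" for j
    using permutes_image[OF perm] that by (metis imageE lessThan_iff)
  from this[of 0] this[of 1] False obtain i j where
    "i < 2 * m" "g i = 0" "j < 2 * m" "g j = 1"
    by auto
  then have "even (g 0) \<noteq> even (g 1)"
    using par[of i] par[of j] by (auto split: if_splits)
  with par show ?thesis by auto
qed simp

section \<open>Splitting a class-preserving symmetry\<close>

text \<open>A shorter factor starting at \<open>k\<close> appears, complemented, on the even
  positions of the factor at \<open>2 * k\<close> and on the odd positions of the factor at
  \<open>2 * k - 1\<close>. Applying \<open>g\<close> to these and halving the indices shows that
  \<open>a\<close> and \<open>b\<close> are symmetries.\<close>

lemma symmetry_eq_weave: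
  assumes G: "g \<in> symmetry_group (2 * m) period_doubling"
    and par: "\<forall>i<2 * m. even (g i) \<longleftrightarrow> even i"
  obtains a b where "a \<in> symmetry_group m period_doubling" "b \<in> symmetry_group m period_doubling"
    "g = weave a b"
proof -
  define a where "a t = g (2 * t) div 2" for t
  define b where "b t = g (Suc (2 * t)) div 2" for t
  note g = symmetry_groupD[OF G]
  have par': "even (g i) \<longleftrightarrow> even i" for i
    using par permutes_lessThan_ge[OF g(1)] by (cases "i < 2 * m") auto
  have ga: "g (2 * t) = 2 * a t" for t
    using par'[of "2 * t"] by (simp add: a_def)
  have gb: "g (Suc (2 * t)) = Suc (2 * b t)" for t
    using par'[of "Suc (2 * t)"] by (auto simp: b_def elim!: oddE)
  have less: "a t < m \<longleftrightarrow> t < m" "b t < m \<longleftrightarrow> t < m" for t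
    using permutes_lessThan_less[OF g(1), of "2 * t"]
      permutes_lessThan_less[OF g(1), of "Suc (2 * t)"]
    unfolding ga gb by presburger+
  have eq: "g = weave a b"
  proof
    fix i
    show "g i = weave a b i"
      by (cases "even i") (auto elim!: evenE oddE simp: ga gb)
  qed
  have a: "a permutes {..<m}"
  proof (rule permutes_lessThanI)
    show "i = j" if "a i = a j" for i j
      using that permutes_eq_iff[OF g(1), of "2 * i" "2 * j"] by (simp add: ga)
    show "a i = i" if "m \<le> i" for i
      using permutes_lessThan_ge[OF g(1), of "2 * i"] that by (simp add: ga)
  qed (simp add: less)
  have b: "b permutes {..<m}"
  proof (rule permutes_lessThanI)
    show "i = j" if "b i = b j" for i j
      using that permutes_eq_iff[OF g(1), of "Suc (2 * i)" "Suc (2 * j)"] by (simp add: gb)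
    show "b i = i" if "m \<le> i" for i
      using permutes_lessThan_ge[OF g(1), of "Suc (2 * i)"] that by (simp add: gb)
  qed (simp add: less)
  \<comment> \<open>Subtraction from 1 truncates, so cancelling it requires that letters are at most
    1.\<close>
  have compl_inj: "period_doubling x = period_doubling y"
    if "period_doubling (2 * x) = period_doubling (2 * y)" "x \<ge> 1" "y \<ge> 1" for x y
    using that period_doubling_le_1[of x] period_doubling_le_1[of y]
    by (simp add: period_doubling_double)
  have one: "period_doubling x = 1" if "period_doubling (2 * x) = 0" "x \<ge> 1" for x
    using that period_doubling_le_1[of x] by (simp add: period_doubling_double)
  have "a \<in> symmetry_group m period_doubling"
    unfolding mem_symmetry_group_iff
  proof (intro conjI allI impI a)
    fix k :: nat
    assume k: "k \<ge> 1"
    then obtain l where l: "l \<ge> 1"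
      "\<forall>j<2 * m. period_doubling (l + g j) = period_doubling (2 * k + j)"
      using g(2)[of "2 * k"] by auto
    have l2: "period_doubling (l + 2 * a t) = period_doubling (2 * (k + t))" if "t < m" for t
      using l(2)[rule_format, of "2 * t"] that unfolding ga by (simp add: distrib_left)
    show "\<exists>l\<ge>1. \<forall>j<m. period_doubling (l + a j) = period_doubling (k + j)"
    proof (cases "even l")
      case True
      then obtain l' where l': "l = 2 * l'" by (elim evenE)
      have "period_doubling (l' + a j) = period_doubling (k + j)" if "j < m" for j
        by (rule compl_inj) (use l2[OF that] l(1) k in \<open>simp_all add: l' distrib_left\<close>)
      then show ?thesis using l(1) l' by (intro exI[of _ l']) auto
    next
      case False
      \<comment> \<open>then the factor at \<open>k\<close> consists of ones only, so any permutation fixes it\<close>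
      have "period_doubling (k + j) = 1" if "j < m" for j
        by (rule one) (use l2[OF that] False k in \<open>simp_all add: period_doubling_odd\<close>)
      then show ?thesis using k less by auto
    qed
  qed
  moreover have "b \<in> symmetry_group m period_doubling"
    unfolding mem_symmetry_group_iff
  proof (intro conjI allI impI b)
    fix k :: nat
    assume k: "k \<ge> 1"
    then have "2 * k - 1 \<ge> 1" by linarith
    then obtain l where l: "l \<ge> 1"
      "\<forall>j<2 * m. period_doubling (l + g j) = period_doubling (2 * k - 1 + j)"
      using g(2) by blast
    have l2: "period_doubling (Suc l + 2 * b t) = period_doubling (2 * (k + t))" if "t < m" for t
    proof -
      have "Suc (2 * t) < 2 * m" using that by simp
      with l(2) have "period_doubling (l + g (Suc (2 * t))) =
          period_doubling (2 * k - 1 + Suc (2 * t))"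
        by blast
      also have "2 * k - 1 + Suc (2 * t) = 2 * (k + t)" using k by simp
      finally show ?thesis by (simp add: gb)
    qed
    show "\<exists>l\<ge>1. \<forall>j<m. period_doubling (l + b j) = period_doubling (k + j)"
    proof (cases "even (Suc l)")
      case True
      then obtain l' where l': "Suc l = 2 * l'" by (elim evenE)
      have "l' \<ge> 1" using l' by presburger
      have "period_doubling (l' + b j) = period_doubling (k + j)" if "j < m" for j
        by (rule compl_inj)
          (use l2[OF that, unfolded l'] k \<open>l' \<ge> 1\<close> in \<open>simp_all add: distrib_left\<close>)
      then show ?thesis using \<open>l' \<ge> 1\<close> by blast
    next
      case False
      \<comment> \<open>The odd positions now fall on odd indices and read zeros, so the shorter
        factor consists of ones and the start \<open>k\<close> itself serves.\<close>
      have "period_doubling (k + j) = 1" if "j < m" for j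
        by (rule one)
          (use l2[OF that] False k period_doubling_odd[of "Suc l + 2 * b j"] in simp_all)
      then show ?thesis using k less by auto
    qed
  qed
  ultimately show ?thesis
    using eq that by blast
qed

section \<open>Group orders at even lengths\<close>

text \<open>\<open>?H\<close> is the subgroup preserving the classes, and left composition with
  \<open>swap_parity m\<close> carries it bijectively onto its only other coset. For
  \<open>m = 0\<close> there is no position to exchange and the factor 2 would be wrong.\<close>

lemma card_symmetry_group_even:
  assumes "m \<ge> 1"
  shows "card (symmetry_group (2 * m) period_doubling) =
    2 * (card (symmetry_group m period_doubling))\<^sup>2" (is "card ?G = 2 * (card ?A)\<^sup>2")
proof -
  let ?H = "(\<lambda>(g, h). weave g h) ` (?A \<times> ?A)"
  let ?s = "(\<circ>) (swap_parity m)"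
  have H: "?H \<subseteq> ?G"
    using weave_mem_symmetry_group[of _ m _ m] by (auto simp: mult_2)
  have s: "?s g \<in> ?G" if "g \<in> ?G" for g
    using swap_parity_mem that by (rule symmetry_group_comp)
  have ss: "?s (?s g) = g" for g :: "nat \<Rightarrow> nat"
    by (simp add: fun_eq_iff)
  have "?G \<subseteq> ?H \<union> ?s ` ?H"
  proof
    fix g
    assume g: "g \<in> ?G"
    have lt: "g i < 2 * m \<longleftrightarrow> i < 2 * m" for i
      using symmetry_groupD(1)[OF g] by (rule permutes_lessThan_less)
    from symmetry_parity_cases[OF g] show "g \<in> ?H \<union> ?s ` ?H"
    proof
      assume "\<forall>i<2 * m. even (g i) \<longleftrightarrow> even i"
      with g show ?thesis by (elim symmetry_eq_weave) auto
    next
      assume "\<forall>i<2 * m. even (g i) \<longleftrightarrow> odd i"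
      then have "\<forall>i<2 * m. even (?s g i) \<longleftrightarrow> even i"
        by (simp add: even_swap_parity lt)
      with s[OF g] have "?s g \<in> ?H" by (elim symmetry_eq_weave) auto
      then show ?thesis using ss by (metis UnCI imageI)
    qed
  qed
  with H s have "?G = ?H \<union> ?s ` ?H" by blast
  \<comment> \<open>The parity of the image of position 0 tells the two cosets apart.\<close>
  moreover have "?H \<inter> ?s ` ?H = {}"
  proof -
    have "even (g 0)" if "g \<in> ?H" for g using that by auto
    moreover have "odd (g 0)" if g: "g \<in> ?s ` ?H" for g
    proof -
      from g obtain h where h: "h \<in> ?H" "g = ?s h" by blast
      have "h \<in> ?G" using h(1) H by blast
      then have "h permutes {..<2 * m}" by (rule symmetry_groupD)
      then have "h 0 < 2 * m" using assms permutes_lessThan_less[of h "2 * m" 0] by simp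
      moreover have "even (h 0)" using h(1) by auto
      ultimately show ?thesis using h(2) even_swap_parity by simp
    qed
    ultimately show ?thesis by blast
  qed
  moreover have "card (?s ` ?H) = card ?H"
    using ss by (intro card_image inj_on_inverseI)
  moreover have "finite ?H"
    using H finite_symmetry_group by (rule finite_subset)
  ultimately have "card ?G = 2 * card ?H"
    by (simp add: card_Un_disjoint)
  then show ?thesis
    by (simp add: card_weave_image power2_eq_square)
qed

section \<open>Growth of the group orders\<close>

lemma card_symmetry_group_1: "card (symmetry_group 1 w) = 1"
proof -
  have "symmetry_group 1 w = {id}"
    by (auto simp: mem_symmetry_group_iff lessThan_Suc permutes_sing)
  then show ?thesis by simp
qed

lemma card_symmetry_group_lower_bound:
  assumes "n \<ge> 2"
  shows "2 ^ n \<le> card (symmetry_group n period_doubling) ^ 3 \<and>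
    (n \<noteq> 3 \<longrightarrow> 2 ^ n < card (symmetry_group n period_doubling) ^ 3)"
  using assms
proof (induction n rule: less_induct)
  case (less n)
  define c where "c k = card (symmetry_group k period_doubling)" for k
  have c1: "c 1 = 1" unfolding c_def by (rule card_symmetry_group_1)
  have c_even: "c (2 * k) = 2 * (c k)\<^sup>2" if "k \<ge> 1" for k
    unfolding c_def using that by (rule card_symmetry_group_even)
  have c2: "c 2 = 2" using c_even[of 1] c1 by simp
  have c_odd: "c (Suc k) * c k \<le> c (2 * k + 1)" for k
    unfolding c_def by (rule card_symmetry_group_odd)
  have IH: "2 ^ k \<le> c k ^ 3" "k \<noteq> 3 \<Longrightarrow> 2 ^ k < c k ^ 3" if "2 \<le> k" "k < n" for k
    using less.IH[OF that(2,1)] unfolding c_def by blast+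
  have "2 ^ n \<le> c n ^ 3 \<and> (n \<noteq> 3 \<longrightarrow> 2 ^ n < c n ^ 3)"
  proof (cases "n \<le> 3")
    case True
    then consider "n = 2" | "n = 3" using less.prems by linarith
    then show ?thesis
    proof cases
      case 1
      then show ?thesis by (simp add: c2)
    next
      case 2
      have "2 \<le> c 3" using c_odd[of 1] c1 c2 by (simp add: numeral_eq_Suc)
      then have "2 ^ 3 \<le> c 3 ^ 3" by (rule power_mono) simp
      with 2 show ?thesis by simp
    qed
  next
    case False
    have "2 ^ n < c n ^ 3"
    proof (cases "even n")
      case True
      then obtain m where m: "n = 2 * m" by (elim evenE)
      then have m2: "2 \<le> m" "m < n" using False by linarith+
      have "2 ^ n = (2 ^ m :: nat)\<^sup>2" by (simp add: m mult.commute flip: power_mult)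
      also have "\<dots> \<le> (c m ^ 3)\<^sup>2" using IH(1)[OF m2] by (rule power_mono) simp
      \<comment> \<open>The 8 is the cube of the factor 2 in \<open>c_even\<close>; it yields
        strictness even for \<open>m = 3\<close>.\<close>
      also have "\<dots> < 8 * (c m ^ 3)\<^sup>2"
      proof -
        have "0 < c m ^ 3" using IH(1)[OF m2] by (rule less_le_trans[rotated]) simp
        then show ?thesis by simp
      qed
      also have "\<dots> = c n ^ 3"
        using c_even[of m] m2 by (simp add: m power_mult_distrib flip: power_mult)
      finally show ?thesis .
    next
      case odd: False
      then obtain m where m: "n = 2 * m + 1" by (elim oddE)
      then have m2: "2 \<le> m" "m < n" "2 \<le> Suc m" "Suc m < n" using False by linarith+
      have "2 ^ n = 2 ^ Suc m * (2 ^ m :: nat)"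
        by (simp add: m flip: power_add power_Suc mult_2)
      \<comment> \<open>At most one of \<open>m\<close> and \<open>Suc m\<close> equals 3, so at
        least one of the two factors satisfies the strict bound.\<close>
      also have "\<dots> < c (Suc m) ^ 3 * c m ^ 3"
      proof (cases "m = 3")
        case True
        then show ?thesis
          using IH(1)[OF m2(1,2)] IH(2)[OF m2(3,4)]
          by (intro mult_less_le_imp_less) auto
      next
        case False
        then show ?thesis
          using IH(2)[OF m2(1,2)] IH(1)[OF m2(3,4)]
          by (intro mult_le_less_imp_less) auto
      qed
      also have "\<dots> = (c (Suc m) * c m) ^ 3"
        by (simp add: power_mult_distrib)
      also have "\<dots> \<le> c n ^ 3"
        using c_odd[of m] unfolding m by (rule power_mono) simp
      finally show ?thesis .
    qed
    then show ?thesis by simp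
  qed
  then show ?case by (simp add: c_def)
qed

text \<open>Doubling the length turns the exponent \<open>e\<close> into \<open>2 * e + 1\<close>;
  starting from 0 this gives \<open>2 ^ n - 1\<close>.\<close>

lemma card_symmetry_group_power_2:
  "card (symmetry_group (2 ^ n) period_doubling) = 2 ^ (2 ^ n - 1)"
proof (induction n)
  case 0
  show ?case using card_symmetry_group_1[of period_doubling] by simp
next
  case (Suc n)
  have "1 + (2 ^ n - 1) * 2 = 2 * 2 ^ n - (1::nat)"
    using one_le_power[of "2::nat" n] by linarith
  moreover have "card (symmetry_group (2 ^ Suc n) period_doubling) = 2 ^ (1 + (2 ^ n - 1) * 2)"
    using card_symmetry_group_even[of "2 ^ n"] by (simp add: Suc flip: power_mult)
  ultimately show ?case by simp
qed

text \<open>The strict bound fails at length 1, where the group is trivial, and at length 3: the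
  factor 101 is the only one with two ones, so the middle position is fixed and the order is 2,
  which is exactly the bound.\<close>

theorem corollary4:
  shows "(\<forall>n::nat. n \<ge> 1 \<and> n \<notin> {1, 3} \<longrightarrow>
            real (card (symmetry_group n period_doubling)) > 2 powr (real n / 3)) \<and>
         (\<forall>n::nat. card (symmetry_group (2 ^ n) period_doubling) = 2 ^ (2 ^ n - 1))"
proof (intro conjI allI impI card_symmetry_group_power_2)
  fix n :: nat
  assume n: "n \<ge> 1 \<and> n \<notin> {1, 3}"
  let ?c = "card (symmetry_group n period_doubling)"
  have "2 ^ n < ?c ^ 3"
    using card_symmetry_group_lower_bound[of n] n by auto
  then have "real (2 ^ n) < real (?c ^ 3)"
    by (rule of_nat_less_iff[THEN iffD2])
  moreover have "(2 powr (real n / 3)) ^ 3 = real (2 ^ n)"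
    by (simp add: powr_power powr_realpow)
  ultimately have "(2 powr (real n / 3)) ^ 3 < real ?c ^ 3"
    by simp
  then show "2 powr (real n / 3) < real ?c"
    by (rule power_less_imp_less_base) simp
qed

end
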